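(* Let $\mathbf T=(T_1,\ldots,T_n)$ be an $n$-tuple of commuting contractions on a Hilbert space. The symmetrization $\mathbf s(\mathbf T)=(s_1(\mathbf T),\ldots,s_n(\mathbf T))$ is a $\Gamma_n$-contraction if and only if $\mathbf T$ satisfies the analogue of von Neumann's inequality for all symmetric polynomials, i.e. $\|q(\mathbf T)\|\le\sup_{z\in\overline{\mathbb D}^n}|q(z)|$ for every symmetric polynomial $q\in\mathbb C[z_1,\ldots,z_n]$.
   Context: $\overline{\mathbb D}$ is the closed unit disc. $s_i(z_1,\ldots,z_n)=\sum_{1\le k_1<\cdots<k_i\le n}z_{k_1}\cdots z_{k_i}$ is the $i$-th elementary symmetric function, $\mathbf s=(s_1,\ldots,s_n):\mathbb C^n\to\mathbb C^n$, and $\Gamma_n:=\mathbf s(\overline{\mathbb D}^n)$. A commuting $n$-tuple $(S_1,\ldots,S_n)$ of bounded operators on a Hilbert space is a $\Gamma_n$-contraction if $\|p(S_1,\ldots,S_n)\|\le\sup_{\Gamma_n}|p|$ for every $p\in\mathbb C[z_1,\ldots,z_n]$. A polynomial is symmetric if it is invariant under all permutations of the variables. *)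

theory Defs
  imports
    "HOL-Analysis.Analysis"
    "HOL-Combinatorics.Permutations"
    "HOL-Library.Poly_Mapping"
begin

subsection \<open>Complex Hilbert spaces\<close>

text \<open>
  The distribution only has real inner product spaces. A complex inner product space is a real normed
  vector space with a compatible complex scalar multiplication, whose norm is induced by a
  sesquilinear form. As in mathematical analysis, the form is linear in its first and
  conjugate-linear in its second argument.
\<close>

class complex_inner_space = real_normed_vector +
  fixes scaleC :: "complex \<Rightarrow> 'a \<Rightarrow> 'a"  (infixr \<open>*\<^sub>C\<close> 75)
    and cinner :: "'a \<Rightarrow> 'a \<Rightarrow> complex"
  assumes scaleC_add_right: "a *\<^sub>C (x + y) = a *\<^sub>C x + a *\<^sub>C y"
    and scaleC_add_left: "(a + b) *\<^sub>C x = a *\<^sub>C x + b *\<^sub>C x"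
    and scaleC_scaleC: "a *\<^sub>C (b *\<^sub>C x) = (a * b) *\<^sub>C x"
    and scaleC_of_real: "complex_of_real r *\<^sub>C x = r *\<^sub>R x"
    and cinner_commute: "cinner x y = cnj (cinner y x)"
    and cinner_add_left: "cinner (x + y) z = cinner x z + cinner y z"
    and cinner_scaleC_left: "cinner (a *\<^sub>C x) y = a * cinner x y"
    and cinner_self: "cinner x x = complex_of_real ((norm x)\<^sup>2)"

class complex_hilbert_space = complex_inner_space + complete_space

instantiation complex :: complex_hilbert_space
begin

definition scaleC_complex :: "complex \<Rightarrow> complex \<Rightarrow> complex" where
  "scaleC_complex a x = a * x"

definition cinner_complex :: "complex \<Rightarrow> complex \<Rightarrow> complex" where
  "cinner_complex x y = x * cnj y"

instance
  by standard
    (simp_all add: scaleC_complex_def cinner_complex_def algebra_simps scaleR_conv_of_real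
      complex_norm_square[symmetric])

end

definition bounded_clinear :: "('a::complex_inner_space \<Rightarrow> 'a) \<Rightarrow> bool" where
  "bounded_clinear f \<longleftrightarrow> bounded_linear f \<and> (\<forall>a x. f (a *\<^sub>C x) = a *\<^sub>C f x)"

definition commuting_contractions ::
    "nat \<Rightarrow> (nat \<Rightarrow> 'a::complex_hilbert_space \<Rightarrow> 'a) \<Rightarrow> bool" where
  "commuting_contractions n T \<longleftrightarrow>
     (\<forall>i\<in>{1..n}. bounded_clinear (T i) \<and> onorm (T i) \<le> 1) \<and>
     (\<forall>i\<in>{1..n}. \<forall>j\<in>{1..n}. T i \<circ> T j = T j \<circ> T i)"

subsection \<open>Polynomials in several variables\<close>

text \<open>
  Variables are indexed by natural numbers. A monomial is the finitely supported map of its exponents,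
  and a polynomial is the finitely supported map of its coefficients; sums and products of polynomials
  are those of the convolution ring structure of \<^theory>\<open>HOL-Library.Poly_Mapping\<close>.
\<close>

type_synonym mpoly = "(nat \<Rightarrow>\<^sub>0 nat) \<Rightarrow>\<^sub>0 complex"

definition polys :: "nat \<Rightarrow> mpoly set" where
  "polys n = {p. \<forall>m\<in>Poly_Mapping.keys p. Poly_Mapping.keys m \<subseteq> {1..n}}"

definition Var :: "nat \<Rightarrow> mpoly" where
  "Var k = Poly_Mapping.single (Poly_Mapping.single k 1) 1"

definition eval_poly :: "(nat \<Rightarrow> complex) \<Rightarrow> mpoly \<Rightarrow> complex" where
  "eval_poly z p =
     (\<Sum>m\<in>Poly_Mapping.keys p. Poly_Mapping.lookup p m *
        (\<Prod>k\<in>Poly_Mapping.keys m. z k ^ Poly_Mapping.lookup m k))"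

text \<open>
  Monomials in operators are composed in increasing order of the indices. The order only
  matters for operators that do not commute.
\<close>

definition eval_monom_op :: "(nat \<Rightarrow> 'a \<Rightarrow> 'a) \<Rightarrow> (nat \<Rightarrow>\<^sub>0 nat) \<Rightarrow> 'a \<Rightarrow> 'a" where
  "eval_monom_op T m =
     foldr (\<lambda>k f. (T k ^^ Poly_Mapping.lookup m k) \<circ> f)
       (sorted_list_of_set (Poly_Mapping.keys m)) id"

definition eval_poly_op :: "(nat \<Rightarrow> 'a::complex_inner_space \<Rightarrow> 'a) \<Rightarrow> mpoly \<Rightarrow> 'a \<Rightarrow> 'a" where
  "eval_poly_op T p =
     (\<lambda>x. \<Sum>m\<in>Poly_Mapping.keys p. Poly_Mapping.lookup p m *\<^sub>C eval_monom_op T m x)"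

text \<open>
  For a permutation \<open>\<sigma>\<close>, the coefficient of \<open>permute_vars \<sigma> p\<close> at the exponents \<open>m\<close> is the
  coefficient of \<open>p\<close> at \<open>m \<circ> \<sigma>\<close>, so that \<open>permute_vars \<sigma>\<close> replaces the variable
  with index \<open>k\<close> by the one with index \<open>\<sigma> k\<close>. (The function \<open>map_key\<close> is meaningful for
  injective maps only.)
\<close>

definition permute_vars :: "(nat \<Rightarrow> nat) \<Rightarrow> mpoly \<Rightarrow> mpoly" where
  "permute_vars \<sigma> p = Poly_Mapping.map_key (Poly_Mapping.map_key \<sigma>) p"

definition symmetric_poly :: "nat \<Rightarrow> mpoly \<Rightarrow> bool" where
  "symmetric_poly n p \<longleftrightarrow> p \<in> polys n \<and> (\<forall>\<sigma>. \<sigma> permutes {1..n} \<longrightarrow> permute_vars \<sigma> p = p)"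

lemma inj_map_key:
  assumes "bij \<sigma>"
  shows "inj (Poly_Mapping.map_key \<sigma> :: (nat \<Rightarrow>\<^sub>0 nat) \<Rightarrow> _)"
proof (rule injI, rule poly_mapping_eqI)
  fix m m' :: "nat \<Rightarrow>\<^sub>0 nat" and k
  assume eq: "Poly_Mapping.map_key \<sigma> m = Poly_Mapping.map_key \<sigma> m'"
  have "Poly_Mapping.lookup (Poly_Mapping.map_key \<sigma> m) (inv \<sigma> k)
      = Poly_Mapping.lookup (Poly_Mapping.map_key \<sigma> m') (inv \<sigma> k)"
    by (simp add: eq)
  then show "Poly_Mapping.lookup m k = Poly_Mapping.lookup m' k"
    using assms by (simp add: map_key.rep_eq bij_is_inj bij_is_surj surj_f_inv_f)
qed

lemma permute_vars_Var:
  assumes "\<sigma> permutes A"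
  shows "permute_vars \<sigma> (Var k) = Var (\<sigma> k)"
proof -
  have \<sigma>: "bij \<sigma>" using assms by (rule permutes_bij)
  then have 1: "Poly_Mapping.map_key \<sigma> (Poly_Mapping.single (\<sigma> k) (1::nat)) = Poly_Mapping.single k 1"
    by (simp add: map_key_single bij_is_inj)
  show ?thesis
    unfolding permute_vars_def Var_def 1[symmetric]
    by (rule map_key_single) (rule inj_map_key[OF \<sigma>])
qed

subsection \<open>Symmetrization\<close>

definition elem_sym :: "nat \<Rightarrow> nat \<Rightarrow> (nat \<Rightarrow> 'b::comm_semiring_1) \<Rightarrow> 'b" where
  "elem_sym n i z = (\<Sum>K | K \<subseteq> {1..n} \<and> card K = i. \<Prod>k\<in>K. z k)"

text \<open>
  Points of \<open>\<complex>\<^sup>n\<close> are functions in \<open>extensional {1..n}\<close>.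
\<close>

definition closed_polydisc :: "nat \<Rightarrow> (nat \<Rightarrow> complex) set" where
  "closed_polydisc n = PiE {1..n} (\<lambda>_. cball 0 1)"

definition symmetrize :: "nat \<Rightarrow> (nat \<Rightarrow> complex) \<Rightarrow> nat \<Rightarrow> complex" where
  "symmetrize n z = (\<lambda>i\<in>{1..n}. elem_sym n i z)"

definition Gamma_set :: "nat \<Rightarrow> (nat \<Rightarrow> complex) set" where
  "Gamma_set n = symmetrize n ` closed_polydisc n"

definition symmetrize_op ::
    "nat \<Rightarrow> (nat \<Rightarrow> 'a::complex_inner_space \<Rightarrow> 'a) \<Rightarrow> nat \<Rightarrow> 'a \<Rightarrow> 'a" where
  "symmetrize_op n T i = eval_poly_op T (elem_sym n i Var)"

definition Gamma_contraction ::
    "nat \<Rightarrow> (nat \<Rightarrow> 'a::complex_hilbert_space \<Rightarrow> 'a) \<Rightarrow> bool" where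
  "Gamma_contraction n S \<longleftrightarrow>
     (\<forall>i\<in>{1..n}. bounded_clinear (S i)) \<and>
     (\<forall>i\<in>{1..n}. \<forall>j\<in>{1..n}. S i \<circ> S j = S j \<circ> S i) \<and>
     (\<forall>p\<in>polys n. onorm (eval_poly_op S p) \<le> (SUP w\<in>Gamma_set n. cmod (eval_poly w p)))"

end

theory Submission
  imports Defs
begin

text \<open>
  Substituting the elementary symmetric polynomials \<open>e\<^sub>1, \<dots>, e\<^sub>n\<close> for the variables turns a polynomial
  \<open>p\<close> into the symmetric polynomial \<open>q = p(e\<^sub>1, \<dots>, e\<^sub>n)\<close>. Evaluation is multiplicative, both at points
  and at commuting operators, so \<open>q(T) = p(s(T))\<close> and \<open>q(z) = p(s(z))\<close>. As the domain \<open>\<Gamma>\<^sub>n\<close> is the image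
  of the closed polydisc under \<open>s\<close>, the supremum of \<open>|p|\<close> over \<open>\<Gamma>\<^sub>n\<close> is that of \<open>|q|\<close> over the polydisc.
  Hence the inequality that defines a \<open>\<Gamma>\<^sub>n\<close>-contraction, for \<open>p\<close> and \<open>s(T)\<close>, is literally von Neumann's
  inequality for \<open>q\<close> and \<open>T\<close>. It remains that \<open>p\<close> and \<open>q\<close> run through all polynomials and all symmetric
  polynomials; the latter is the fundamental theorem of symmetric polynomials.

  The relation \<open>elem_sym_subst n p q\<close> expresses \<open>q = p(e\<^sub>1, \<dots>, e\<^sub>n)\<close>. The two evaluations are compared by
  rule induction in \<open>eval_poly_op_elem_sym_subst\<close> and \<open>eval_poly_elem_sym_subst\<close>, and
  \<open>symmetric_poly_elem_sym_subst\<close> is the fundamental theorem. Its proof is the classical one of Gauss,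
  by well-founded induction on the lexicographically leading monomial \<open>m\<close> of \<open>q\<close>: symmetry makes the
  exponents of \<open>m\<close> decrease, so \<open>m\<close> is also the leading monomial of the product of the
  \<open>e\<^sub>i ^ (m\<^sub>i - m\<^sub>i\<^sub>+\<^sub>1)\<close>, and subtracting a multiple of this product from \<open>q\<close> cancels it.
\<close>

section \<open>Polynomials as sums of monomials\<close>

lemma poly_mapping_sum_induct [consumes 1, case_names zero single add]:
  fixes p :: "'a \<Rightarrow>\<^sub>0 'b::comm_monoid_add"
  assumes "Poly_Mapping.keys p \<subseteq> A"
    and zero: "P 0"
    and single: "\<And>m c. m \<in> A \<Longrightarrow> P (Poly_Mapping.single m c)"
    and add: "\<And>p q. Poly_Mapping.keys p \<subseteq> A \<Longrightarrow> Poly_Mapping.keys q \<subseteq> A \<Longrightarrow> P p \<Longrightarrow> P q \<Longrightarrow> P (p + q)"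
  shows "P p"
proof -
  define s where "s B = (\<Sum>m\<in>B. Poly_Mapping.single m (Poly_Mapping.lookup p m))" for B
  have "Poly_Mapping.keys (s B) \<subseteq> A \<and> P (s B)" if "finite B" "B \<subseteq> A" for B
    using that
  proof (induction B rule: finite_induct)
    case empty
    then show ?case by (simp add: s_def zero)
  next
    case (insert m B)
    have eq: "s (insert m B) = Poly_Mapping.single m (Poly_Mapping.lookup p m) + s B"
      using insert by (simp add: s_def)
    have 1: "Poly_Mapping.keys (Poly_Mapping.single m (Poly_Mapping.lookup p m)) \<subseteq> A"
      using insert.prems by simp
    have 2: "Poly_Mapping.keys (s B) \<subseteq> A" "P (s B)"
      using insert by auto
    have "P (s (insert m B))"
      unfolding eq using insert.prems by (intro add 1 2 single) auto
    moreover have "Poly_Mapping.keys (s (insert m B)) \<subseteq> A"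
      unfolding eq using keys_add 1 2(1) by (meson Un_least order_trans)
    ultimately show ?case by blast
  qed
  from this[of "Poly_Mapping.keys p"] assms(1) have "P (s (Poly_Mapping.keys p))" by simp
  moreover have "s (Poly_Mapping.keys p) = p"
  proof (rule poly_mapping_eqI)
    fix k
    show "Poly_Mapping.lookup (s (Poly_Mapping.keys p)) k = Poly_Mapping.lookup p k"
      by (cases "k \<in> Poly_Mapping.keys p")
        (simp_all add: s_def lookup_sum lookup_single when_def in_keys_iff)
  qed
  ultimately show ?thesis by simp
qed

text \<open>
  Products of polynomials are bilinear, so an additive map is multiplicative as soon as it is so on
  monomials. This yields the multiplicativity of evaluation at points and of permuting the variables.
\<close>

lemma additive_mult_if_mult_monomials:
  fixes F :: "('a::monoid_add \<Rightarrow>\<^sub>0 'b::semiring_0) \<Rightarrow> 'c::ring"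
  assumes add: "\<And>p q. F (p + q) = F p + F q"
    and single: "\<And>m c m' c'. F (Poly_Mapping.single m c * Poly_Mapping.single m' c')
      = F (Poly_Mapping.single m c) * F (Poly_Mapping.single m' c')"
  shows "F (p * q) = F p * F q"
proof -
  have zero: "F 0 = 0"
    using add[of 0 0] by simp
  have *: "F (Poly_Mapping.single m c * q) = F (Poly_Mapping.single m c) * F q" for m c
    using subset_UNIV[of "Poly_Mapping.keys q"]
    by (induction q rule: poly_mapping_sum_induct) (simp_all add: zero add single distrib_left)
  show ?thesis
    using subset_UNIV[of "Poly_Mapping.keys p"]
    by (induction p rule: poly_mapping_sum_induct) (simp_all add: zero add * distrib_right)
qed

lemma zero_in_polys: "0 \<in> polys n"
  by (simp add: polys_def)

lemma single_in_polys: "Poly_Mapping.keys m \<subseteq> {1..n} \<Longrightarrow> Poly_Mapping.single m c \<in> polys n"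
  by (simp add: polys_def)

lemma Var_in_polys: "k \<in> {1..n} \<Longrightarrow> Var k \<in> polys n"
  by (simp add: polys_def Var_def)

lemma polys_add: "p \<in> polys n \<Longrightarrow> q \<in> polys n \<Longrightarrow> p + q \<in> polys n"
  unfolding polys_def using keys_add[of p q] by blast

lemma polys_mult:
  assumes "p \<in> polys n" "q \<in> polys n"
  shows "p * q \<in> polys n"
  unfolding polys_def
proof safe
  fix m k
  assume "m \<in> Poly_Mapping.keys (p * q)" and k: "k \<in> Poly_Mapping.keys m"
  with keys_mult[of p q] obtain a b
    where "m = a + b" "a \<in> Poly_Mapping.keys p" "b \<in> Poly_Mapping.keys q" by blast
  with assms k keys_add[of a b] show "k \<in> {1..n}"
    unfolding polys_def by blast
qed

lemma polys_sum: "(\<And>i. i \<in> I \<Longrightarrow> f i \<in> polys n) \<Longrightarrow> (\<Sum>i\<in>I. f i) \<in> polys n"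
  by (induction I rule: infinite_finite_induct) (auto intro: zero_in_polys polys_add)

lemma prod_Var:
  "(\<Prod>k\<in>K. Var k) = Poly_Mapping.single (\<Sum>k\<in>K. Poly_Mapping.single k 1) 1"
  by (induction K rule: infinite_finite_induct) (simp_all add: Var_def mult_single)

text \<open>
  The sum of the unit exponent vectors over \<open>K\<close> is the exponent vector of the squarefree monomial
  with variables \<open>K\<close>, i.e. the indicator function of \<open>K\<close>.
\<close>

lemma lookup_sum_single:
  assumes "finite K"
  shows "Poly_Mapping.lookup (\<Sum>k\<in>K. Poly_Mapping.single k (Suc 0)) j = (if j \<in> K then 1 else 0)"
  using assms by (simp add: lookup_sum lookup_single when_def)

lemma elem_sym_Var_in_polys: "elem_sym n i Var \<in> polys n"
  unfolding elem_sym_def prod_Var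
proof (intro polys_sum single_in_polys subsetI)
  fix K k
  assume "K \<in> {K. K \<subseteq> {1..n} \<and> card K = i}"
    and "k \<in> Poly_Mapping.keys (\<Sum>k\<in>K. Poly_Mapping.single k (1::nat))"
  then show "k \<in> {1..n}"
    using finite_subset[of K "{1..n}"] by (auto simp: in_keys_iff lookup_sum_single split: if_splits)
qed

text \<open>
  The polynomials in \<open>n\<close> variables are generated as a ring by the constants and the variables: these are
  the cases in which a substitution has to be defined.
\<close>

lemma polys_induct [consumes 1, case_names const var add mult]:
  assumes "p \<in> polys n"
    and const: "\<And>c. P (Poly_Mapping.single 0 c)"
    and var: "\<And>k. k \<in> {1..n} \<Longrightarrow> P (Var k)"
    and add: "\<And>p q. P p \<Longrightarrow> P q \<Longrightarrow> P (p + q)"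
    and mult: "\<And>p q. P p \<Longrightarrow> P q \<Longrightarrow> P (p * q)"
  shows "P p"
proof -
  have power: "P (Poly_Mapping.single (Poly_Mapping.single k e) 1)" if "k \<in> {1..n}" for k e
  proof (induction e)
    case 0
    then show ?case using const[of 1] by simp
  next
    case (Suc e)
    have "Poly_Mapping.single (Poly_Mapping.single k (Suc e)) 1
        = Var k * Poly_Mapping.single (Poly_Mapping.single k e) 1"
      by (simp add: Var_def mult_single flip: single_add)
    with mult[OF var[OF that] Suc] show ?case by simp
  qed
  have monom: "P (Poly_Mapping.single m 1)" if "Poly_Mapping.keys m \<subseteq> {1..n}" for m
    using that
  proof (induction m rule: poly_mapping_sum_induct)
    case zero
    then show ?case using const[of 1] by simp
  next
    case (single k e)
    then show ?case by (rule power)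
  next
    case (add m m')
    then show ?case
      using mult[of "Poly_Mapping.single m 1" "Poly_Mapping.single m' 1"] by (simp add: mult_single)
  qed
  have "Poly_Mapping.keys p \<subseteq> {m. Poly_Mapping.keys m \<subseteq> {1..n}}"
    using assms(1) by (auto simp: polys_def)
  then show ?thesis
  proof (induction p rule: poly_mapping_sum_induct)
    case zero
    then show ?case using const[of 0] by simp
  next
    case (single m c)
    then show ?case
      using mult[OF const[of c] monom[of m]] by (simp add: mult_single)
  next
    case (add p q)
    then show ?case using assms(4) by blast
  qed
qed

section \<open>Evaluation at points\<close>

lemma eval_poly_single:
  "eval_poly z (Poly_Mapping.single m c)
    = c * (\<Prod>k\<in>Poly_Mapping.keys m. z k ^ Poly_Mapping.lookup m k)"
  by (simp add: eval_poly_def)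

lemma eval_poly_add: "eval_poly z (p + q) = eval_poly z p + eval_poly z q"
  unfolding eval_poly_def
  by (rule setsum_keys_plus_distrib) (simp_all add: distrib_right)

text \<open>
  The three products range over different sets of variables; extending each to the union of the
  supports only adds zeroth powers.
\<close>

lemma eval_monom_add:
  fixes z :: "nat \<Rightarrow> complex"
  shows "(\<Prod>k\<in>Poly_Mapping.keys (m + m'). z k ^ Poly_Mapping.lookup (m + m') k)
    = (\<Prod>k\<in>Poly_Mapping.keys m. z k ^ Poly_Mapping.lookup m k)
      * (\<Prod>k\<in>Poly_Mapping.keys m'. z k ^ Poly_Mapping.lookup m' k)"
proof -
  let ?A = "Poly_Mapping.keys m \<union> Poly_Mapping.keys m'"
  have *: "(\<Prod>k\<in>Poly_Mapping.keys r. z k ^ Poly_Mapping.lookup r k)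
      = (\<Prod>k\<in>?A. z k ^ Poly_Mapping.lookup r k)" if "Poly_Mapping.keys r \<subseteq> ?A" for r
    using that by (intro prod.mono_neutral_left) (auto simp: in_keys_iff)
  show ?thesis
    unfolding *[of "m + m'", OF keys_add] *[of m, OF Un_upper1] *[of m', OF Un_upper2]
    by (simp add: lookup_add power_add prod.distrib)
qed

lemma eval_poly_mult: "eval_poly z (p * q) = eval_poly z p * eval_poly z q"
  by (rule additive_mult_if_mult_monomials)
    (simp_all add: eval_poly_add mult_single eval_poly_single eval_monom_add)

lemma eval_poly_Var: "eval_poly z (Var k) = z k"
  by (simp add: Var_def eval_poly_single)

lemma eval_poly_sum: "eval_poly z (\<Sum>i\<in>I. f i) = (\<Sum>i\<in>I. eval_poly z (f i))"
  by (induction I rule: infinite_finite_induct) (simp_all add: eval_poly_add, simp_all add: eval_poly_def)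

lemma eval_poly_prod: "eval_poly z (\<Prod>i\<in>I. f i) = (\<Prod>i\<in>I. eval_poly z (f i))"
  by (induction I rule: infinite_finite_induct) (simp_all add: eval_poly_mult, simp_all add: eval_poly_def)

lemma eval_poly_elem_sym: "eval_poly z (elem_sym n i Var) = elem_sym n i z"
  by (simp add: elem_sym_def eval_poly_sum eval_poly_prod eval_poly_Var)

section \<open>Evaluation at commuting operators\<close>

lemma scaleC_zero_left: "0 *\<^sub>C x = (0::'a::complex_inner_space)"
  using scaleC_of_real[of 0 x] by simp

lemma scaleC_one: "1 *\<^sub>C x = (x::'a::complex_inner_space)"
  using scaleC_of_real[of 1 x] by simp

lemma scaleC_zero_right: "c *\<^sub>C 0 = (0::'a::complex_inner_space)"
  using scaleC_add_right[of c 0 "0::'a"] by simp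

lemma norm_scaleC: "norm (c *\<^sub>C x) = cmod c * norm (x::'a::complex_inner_space)"
proof -
  have "complex_of_real ((norm (c *\<^sub>C x))\<^sup>2) = cinner (c *\<^sub>C x) (c *\<^sub>C x)"
    by (simp add: cinner_self)
  also have "\<dots> = c * cnj (c * cinner x x)"
    by (metis cinner_commute cinner_scaleC_left)
  also have "\<dots> = complex_of_real ((cmod c * norm x)\<^sup>2)"
    using complex_norm_square[of c] by (simp add: cinner_self power_mult_distrib)
  finally have "(norm (c *\<^sub>C x))\<^sup>2 = (cmod c * norm x)\<^sup>2"
    using of_real_eq_iff by blast
  then show ?thesis by (simp add: power2_eq_iff_nonneg)
qed

lemma bounded_clinear_id: "bounded_clinear id"
  by (simp add: bounded_clinear_def id_def bounded_linear_ident)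

lemma bounded_clinear_comp: "bounded_clinear f \<Longrightarrow> bounded_clinear g \<Longrightarrow> bounded_clinear (f \<circ> g)"
  unfolding bounded_clinear_def comp_def by (auto intro: bounded_linear_compose)

lemma bounded_clinear_funpow: "bounded_clinear f \<Longrightarrow> bounded_clinear (f ^^ k)"
  by (induction k) (auto intro: bounded_clinear_comp simp: bounded_clinear_id[unfolded id_def] id_def)

lemma bounded_clinear_scaleC: "bounded_clinear (\<lambda>x. c *\<^sub>C x)"
  unfolding bounded_clinear_def
proof safe
  have "c *\<^sub>C (r *\<^sub>R x) = r *\<^sub>R (c *\<^sub>C x)" for r and x :: 'a
    by (simp flip: scaleC_of_real add: scaleC_scaleC mult.commute)
  then show "bounded_linear (\<lambda>x::'a. c *\<^sub>C x)"
    by (intro bounded_linear_intro[where K = "cmod c"])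
      (simp_all add: scaleC_add_right norm_scaleC mult.commute)
qed (simp add: scaleC_scaleC mult.commute)

lemma bounded_clinear_zero: "bounded_clinear (\<lambda>x. 0)"
  by (simp add: bounded_clinear_def scaleC_zero_right bounded_linear_zero)

lemma bounded_clinear_add:
  "bounded_clinear f \<Longrightarrow> bounded_clinear g \<Longrightarrow> bounded_clinear (\<lambda>x. f x + g x)"
  by (simp add: bounded_clinear_def bounded_linear_add scaleC_add_right)

lemma bounded_clinear_sum:
  "(\<And>i. i \<in> I \<Longrightarrow> bounded_clinear (f i)) \<Longrightarrow> bounded_clinear (\<lambda>x. \<Sum>i\<in>I. f i x)"
  by (induction I rule: infinite_finite_induct) (auto intro: bounded_clinear_zero bounded_clinear_add)

lemma
  assumes "bounded_clinear f"
  shows bounded_clinearD_add: "f (x + y) = f x + f y"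
    and bounded_clinearD_zero: "f 0 = 0"
    and bounded_clinearD_scaleC: "f (c *\<^sub>C x) = c *\<^sub>C f x"
  using assms by (auto simp: bounded_clinear_def bounded_linear.linear linear_add linear_0)

text \<open>
  Unlike contractivity, this property passes from a tuple to its symmetrization, so that both have a
  polynomial functional calculus.
\<close>

definition commuting_operators ::
    "nat \<Rightarrow> (nat \<Rightarrow> 'a::complex_inner_space \<Rightarrow> 'a) \<Rightarrow> bool" where
  "commuting_operators n T \<longleftrightarrow>
     (\<forall>i\<in>{1..n}. bounded_clinear (T i)) \<and>
     (\<forall>i\<in>{1..n}. \<forall>j\<in>{1..n}. T i \<circ> T j = T j \<circ> T i)"

lemma funpow_comp_commute:
  assumes "f \<circ> g = g \<circ> f"
  shows "f \<circ> (g ^^ k) = (g ^^ k) \<circ> f"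
proof (induction k)
  case (Suc k)
  then show ?case using assms by (simp add: fun_eq_iff)
qed simp

text \<open>
  The operator word of a monomial, taken along an arbitrary list of indices instead of
  the support of the exponents. Two monomials with different supports can then be written along the
  same list, and induction on the list applies.
\<close>

definition op_word :: "(nat \<Rightarrow> 'a \<Rightarrow> 'a) \<Rightarrow> (nat \<Rightarrow> nat) \<Rightarrow> nat list \<Rightarrow> 'a \<Rightarrow> 'a" where
  "op_word T e ks = foldr (\<lambda>k f. (T k ^^ e k) \<circ> f) ks id"

lemma op_word_Nil: "op_word T e [] = id"
  and op_word_Cons: "op_word T e (k # ks) = (T k ^^ e k) \<circ> op_word T e ks"
  by (simp_all add: op_word_def)

lemma op_word_commute:
  assumes "\<And>k. k \<in> set ks \<Longrightarrow> g \<circ> T k = T k \<circ> g"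
  shows "g \<circ> op_word T e ks = op_word T e ks \<circ> g"
  using assms
proof (induction ks)
  case (Cons k ks)
  have "g \<circ> (T k ^^ e k) = (T k ^^ e k) \<circ> g"
    by (rule funpow_comp_commute[OF Cons.prems]) simp
  moreover have "g \<circ> op_word T e ks = op_word T e ks \<circ> g"
    by (rule Cons.IH[OF Cons.prems]) simp
  ultimately show ?case
    by (metis op_word_Cons comp_assoc)
qed (simp add: op_word_Nil)

lemma op_word_add:
  assumes "\<And>j k. j \<in> set ks \<Longrightarrow> k \<in> set ks \<Longrightarrow> T j \<circ> T k = T k \<circ> T j"
  shows "op_word T (\<lambda>k. d k + e k) ks = op_word T d ks \<circ> op_word T e ks"
  using assms
proof (induction ks)
  case (Cons k ks)
  have commute: "(T k ^^ e k) \<circ> op_word T d ks = op_word T d ks \<circ> (T k ^^ e k)"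
    by (intro op_word_commute funpow_comp_commute[symmetric] Cons.prems) auto
  have IH: "op_word T (\<lambda>k. d k + e k) ks = op_word T d ks \<circ> op_word T e ks"
    by (rule Cons.IH, rule Cons.prems) auto
  have "op_word T (\<lambda>k. d k + e k) (k # ks)
      = (T k ^^ d k) \<circ> ((T k ^^ e k) \<circ> op_word T d ks) \<circ> op_word T e ks"
    by (simp only: op_word_Cons IH funpow_add comp_assoc)
  also have "\<dots> = op_word T d (k # ks) \<circ> op_word T e (k # ks)"
    by (simp only: commute op_word_Cons comp_assoc)
  finally show ?case .
qed (simp add: op_word_Nil)

text \<open>
  Indices outside the support contribute the zeroth power of an operator, so the whole list of indices
  may be used for every monomial.
\<close>

lemma eval_monom_op_word:
  assumes "Poly_Mapping.keys m \<subseteq> {1..n}"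
  shows "eval_monom_op T m = op_word T (Poly_Mapping.lookup m) [1..<Suc n]"
proof -
  have "sorted_list_of_set (Poly_Mapping.keys m)
      = filter (\<lambda>k. k \<in> Poly_Mapping.keys m) [1..<Suc n]"
  proof (rule sorted_distinct_set_unique)
    show "sorted (filter (\<lambda>k. k \<in> Poly_Mapping.keys m) [1..<Suc n])"
      by (metis sorted_upt sorted_wrt_filter)
  qed (use assms in auto)
  moreover have "op_word T (Poly_Mapping.lookup m) (filter (\<lambda>k. k \<in> Poly_Mapping.keys m) ks)
      = op_word T (Poly_Mapping.lookup m) ks" for ks
    by (induction ks) (auto simp: in_keys_iff op_word_Nil op_word_Cons)
  ultimately show ?thesis by (simp add: eval_monom_op_def op_word_def)
qed

lemma eval_monom_op_add:
  assumes "commuting_operators n T"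
    and "Poly_Mapping.keys m \<subseteq> {1..n}" "Poly_Mapping.keys m' \<subseteq> {1..n}"
  shows "eval_monom_op T (m + m') = eval_monom_op T m \<circ> eval_monom_op T m'"
proof -
  have "Poly_Mapping.keys (m + m') \<subseteq> {1..n}"
    using assms keys_add[of m m'] by blast
  moreover have "Poly_Mapping.lookup (m + m')
      = (\<lambda>k. Poly_Mapping.lookup m k + Poly_Mapping.lookup m' k)"
    by (simp add: fun_eq_iff lookup_add)
  moreover have "T j \<circ> T k = T k \<circ> T j" if "j \<in> set [1..<Suc n]" "k \<in> set [1..<Suc n]" for j k
    using assms(1) that unfolding commuting_operators_def
    by (simp only: set_upt atLeastLessThanSuc_atLeastAtMost)
  ultimately show ?thesis
    using assms by (simp only: eval_monom_op_word op_word_add)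
qed

lemma bounded_clinear_eval_monom_op:
  assumes "commuting_operators n T" "Poly_Mapping.keys m \<subseteq> {1..n}"
  shows "bounded_clinear (eval_monom_op T m)"
proof -
  have "bounded_clinear (op_word T e ks)" if "\<And>k. k \<in> set ks \<Longrightarrow> bounded_clinear (T k)" for e ks
    using that
    by (induction ks)
      (simp_all add: op_word_Nil op_word_Cons bounded_clinear_id bounded_clinear_comp
        bounded_clinear_funpow)
  moreover have "bounded_clinear (T k)" if "k \<in> set [1..<Suc n]" for k
    using assms(1) that unfolding commuting_operators_def
    by (simp only: set_upt atLeastLessThanSuc_atLeastAtMost)
  ultimately show ?thesis
    unfolding eval_monom_op_word[OF assms(2)] by blast
qed

lemma bounded_clinear_eval_poly_op:
  assumes "commuting_operators n T" "p \<in> polys n"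
  shows "bounded_clinear (eval_poly_op T p)"
  unfolding eval_poly_op_def
proof (rule bounded_clinear_sum)
  fix m assume "m \<in> Poly_Mapping.keys p"
  with assms show "bounded_clinear (\<lambda>x. Poly_Mapping.lookup p m *\<^sub>C eval_monom_op T m x)"
    using bounded_clinear_comp[OF bounded_clinear_scaleC[of "Poly_Mapping.lookup p m"]
        bounded_clinear_eval_monom_op[of n T m]]
    by (auto simp: polys_def comp_def)
qed

lemma eval_poly_op_zero: "eval_poly_op T 0 x = 0"
  by (simp add: eval_poly_op_def)

lemma eval_poly_op_single:
  "eval_poly_op T (Poly_Mapping.single m c) x = c *\<^sub>C eval_monom_op T m x"
  by (simp add: eval_poly_op_def scaleC_zero_left)

lemma eval_poly_op_add: "eval_poly_op T (p + q) x = eval_poly_op T p x + eval_poly_op T q x"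
  unfolding eval_poly_op_def
  by (rule setsum_keys_plus_distrib) (simp_all add: scaleC_add_left scaleC_zero_left)

text \<open>
  The polynomial functional calculus is multiplicative. Commutativity is used for the product of two
  monomials, and linearity of the operators to move sums and scalars of the second factor through
  the first.
\<close>

lemma eval_poly_op_mult:
  assumes T: "commuting_operators n T" and "p \<in> polys n" "q \<in> polys n"
  shows "eval_poly_op T (p * q) x = eval_poly_op T p (eval_poly_op T q x)"
proof -
  let ?M = "{m. Poly_Mapping.keys m \<subseteq> {1..n}}"
  have *: "eval_poly_op T (Poly_Mapping.single m c * q) x
      = eval_poly_op T (Poly_Mapping.single m c) (eval_poly_op T q x)"
    if m: "Poly_Mapping.keys m \<subseteq> {1..n}" for m c
  proof -
    note lin = bounded_clinear_eval_monom_op[OF T m]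
    have "Poly_Mapping.keys q \<subseteq> ?M"
      using assms by (auto simp: polys_def)
    then show ?thesis
    proof (induction q rule: poly_mapping_sum_induct)
      case zero
      then show ?case
        by (simp add: eval_poly_op_zero eval_poly_op_single bounded_clinearD_zero[OF lin] scaleC_zero_right)
    next
      case (single m' c')
      then show ?case
        by (simp add: mult_single eval_poly_op_single eval_monom_op_add[OF T m]
            bounded_clinearD_scaleC[OF lin] scaleC_scaleC)
    next
      case (add q q')
      then show ?case
        by (simp add: distrib_left eval_poly_op_add eval_poly_op_single bounded_clinearD_add[OF lin]
            scaleC_add_right)
    qed
  qed
  have "Poly_Mapping.keys p \<subseteq> ?M"
    using assms by (auto simp: polys_def)
  then show ?thesis
    by (induction p rule: poly_mapping_sum_induct)
      (simp_all add: eval_poly_op_zero eval_poly_op_add distrib_right *)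
qed

lemma eval_poly_op_Var: "eval_poly_op T (Var k) = T k"
  by (simp add: fun_eq_iff Var_def eval_poly_op_single eval_monom_op_def scaleC_one)

text \<open>
  The operators \<open>s\<^sub>i(T)\<close> commute because the polynomials \<open>e\<^sub>i\<close> do and the functional calculus is
  multiplicative.
\<close>

lemma commuting_operators_symmetrize_op:
  assumes "commuting_operators n T"
  shows "commuting_operators n (symmetrize_op n T)"
  unfolding commuting_operators_def
proof (intro conjI ballI)
  show "bounded_clinear (symmetrize_op n T i)" for i
    unfolding symmetrize_op_def
    by (rule bounded_clinear_eval_poly_op[OF assms elem_sym_Var_in_polys])
  show "symmetrize_op n T i \<circ> symmetrize_op n T j = symmetrize_op n T j \<circ> symmetrize_op n T i" for i j
    by (simp add: fun_eq_iff symmetrize_op_def mult.commute elem_sym_Var_in_polys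
        flip: eval_poly_op_mult[OF assms])
qed

section \<open>Symmetric polynomials\<close>

lemma lookup_permute_vars:
  "\<sigma> permutes A \<Longrightarrow> Poly_Mapping.lookup (permute_vars \<sigma> p) m
    = Poly_Mapping.lookup p (Poly_Mapping.map_key \<sigma> m)"
  by (simp add: permute_vars_def map_key.rep_eq inj_map_key permutes_bij)

lemma permute_vars_add: "\<sigma> permutes A \<Longrightarrow> permute_vars \<sigma> (p + q) = permute_vars \<sigma> p + permute_vars \<sigma> q"
  by (simp add: permute_vars_def map_key_plus inj_map_key permutes_bij)

lemma permute_vars_single:
  assumes "\<sigma> permutes A"
  shows "permute_vars \<sigma> (Poly_Mapping.single m c)
    = Poly_Mapping.single (Poly_Mapping.map_key (inv \<sigma>) m) c"
proof -
  have "m = Poly_Mapping.map_key \<sigma> (Poly_Mapping.map_key (inv \<sigma>) m)"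
    by (intro poly_mapping_eqI)
      (simp add: map_key.rep_eq permutes_inj[OF assms] permutes_inj[OF permutes_inv[OF assms]]
        permutes_inverses[OF assms])
  then show ?thesis
    using map_key_single[OF inj_map_key[OF permutes_bij[OF assms]], of "Poly_Mapping.map_key (inv \<sigma>) m" c]
    by (simp add: permute_vars_def)
qed

lemma permute_vars_mult:
  assumes "\<sigma> permutes A"
  shows "permute_vars \<sigma> (p * q) = permute_vars \<sigma> p * permute_vars \<sigma> q"
  by (rule additive_mult_if_mult_monomials)
    (simp_all add: permute_vars_add[OF assms] permute_vars_single[OF assms] mult_single map_key_plus
      permutes_inj[OF permutes_inv[OF assms]])

lemma permute_vars_const: "\<sigma> permutes A \<Longrightarrow>
    permute_vars \<sigma> (Poly_Mapping.single 0 c) = Poly_Mapping.single 0 c"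
  by (simp add: permute_vars_single permutes_inj[OF permutes_inv])

lemma permute_vars_sum: "\<sigma> permutes A \<Longrightarrow> permute_vars \<sigma> (\<Sum>i\<in>I. f i) = (\<Sum>i\<in>I. permute_vars \<sigma> (f i))"
  using permute_vars_const[of \<sigma> A 0]
  by (induction I rule: infinite_finite_induct) (simp_all add: permute_vars_add)

lemma permute_vars_prod: "\<sigma> permutes A \<Longrightarrow> permute_vars \<sigma> (\<Prod>i\<in>I. f i) = (\<Prod>i\<in>I. permute_vars \<sigma> (f i))"
  using permute_vars_const[of \<sigma> A 1]
  by (induction I rule: infinite_finite_induct) (simp_all add: permute_vars_mult)

text \<open>
  A permutation of the variables permutes the \<open>i\<close>-element sets of variables, hence the summands.
\<close>

lemma permute_vars_elem_sym:
  assumes \<sigma>: "\<sigma> permutes {1..n}"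
  shows "permute_vars \<sigma> (elem_sym n i Var) = elem_sym n i Var"
proof -
  let ?S = "{K. K \<subseteq> {1..n} \<and> card K = i}"
  have inj: "inj_on \<sigma> K" for K
    using permutes_inj[OF \<sigma>] by (simp add: inj_on_def)
  have "permute_vars \<sigma> (elem_sym n i Var) = (\<Sum>K\<in>?S. \<Prod>k\<in>K. Var (\<sigma> k))"
    by (simp add: elem_sym_def permute_vars_sum[OF \<sigma>] permute_vars_prod[OF \<sigma>] permute_vars_Var[OF \<sigma>])
  also have "\<dots> = (\<Sum>K\<in>?S. \<Prod>k\<in>\<sigma> ` K. Var k)"
    by (simp add: prod.reindex[OF inj])
  also have "\<dots> = (\<Sum>K\<in>?S. \<Prod>k\<in>K. Var k)"
  proof (rule sum.reindex_bij_witness[where i = "\<lambda>K. inv \<sigma> ` K" and j = "\<lambda>K. \<sigma> ` K"])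
    fix K assume K: "K \<in> ?S"
    show "inv \<sigma> ` \<sigma> ` K = K" "\<sigma> ` inv \<sigma> ` K = K"
      using \<sigma> by (simp_all add: image_image permutes_inverses)
    show "\<sigma> ` K \<in> ?S"
      using K permutes_image[OF \<sigma>] by (auto simp: card_image[OF inj])
    have "inj_on (inv \<sigma>) K"
      using permutes_inj[OF permutes_inv[OF \<sigma>]] by (rule inj_on_subset) simp
    moreover have "inv \<sigma> ` K \<subseteq> {1..n}"
      using K image_mono[of K "{1..n}" "inv \<sigma>"] permutes_image[OF permutes_inv[OF \<sigma>]] by auto
    ultimately show "inv \<sigma> ` K \<in> ?S"
      using K by (simp add: card_image)
  qed simp
  finally show ?thesis by (simp add: elem_sym_def)
qed

lemma symmetric_poly_const: "symmetric_poly n (Poly_Mapping.single 0 c)"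
  by (auto simp: symmetric_poly_def single_in_polys permute_vars_const)

lemma symmetric_poly_elem_sym: "symmetric_poly n (elem_sym n i Var)"
  by (simp add: symmetric_poly_def elem_sym_Var_in_polys permute_vars_elem_sym)

lemma symmetric_poly_add: "symmetric_poly n p \<Longrightarrow> symmetric_poly n q \<Longrightarrow> symmetric_poly n (p + q)"
  by (auto simp: symmetric_poly_def polys_add permute_vars_add)

lemma symmetric_poly_mult: "symmetric_poly n p \<Longrightarrow> symmetric_poly n q \<Longrightarrow> symmetric_poly n (p * q)"
  by (auto simp: symmetric_poly_def polys_mult permute_vars_mult)

section \<open>Substitution of the elementary symmetric polynomials\<close>

text \<open>
  The graph of the substitution \<open>p \<mapsto> p(e\<^sub>1, \<dots>, e\<^sub>n)\<close>. Every property that is compatible with the ring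
  operations transfers from \<open>p\<close> to \<open>q\<close> by rule induction, and for the existence statements in both
  directions it suffices to build up a pair by the rules.
\<close>

inductive elem_sym_subst :: "nat \<Rightarrow> mpoly \<Rightarrow> mpoly \<Rightarrow> bool" for n where
  const: "elem_sym_subst n (Poly_Mapping.single 0 c) (Poly_Mapping.single 0 c)"
| var: "k \<in> {1..n} \<Longrightarrow> elem_sym_subst n (Var k) (elem_sym n k Var)"
| add: "elem_sym_subst n p q \<Longrightarrow> elem_sym_subst n p' q' \<Longrightarrow> elem_sym_subst n (p + p') (q + q')"
| mult: "elem_sym_subst n p q \<Longrightarrow> elem_sym_subst n p' q' \<Longrightarrow> elem_sym_subst n (p * p') (q * q')"

lemma elem_sym_subst_exists:
  assumes "p \<in> polys n"
  shows "\<exists>q. elem_sym_subst n p q"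
  using assms by (induction p rule: polys_induct) (blast intro: elem_sym_subst.intros)+

lemma elem_sym_subst_in_polys: "elem_sym_subst n p q \<Longrightarrow> p \<in> polys n"
  by (induction rule: elem_sym_subst.induct)
    (simp_all add: single_in_polys Var_in_polys polys_add polys_mult)

lemma elem_sym_subst_symmetric: "elem_sym_subst n p q \<Longrightarrow> symmetric_poly n q"
  by (induction rule: elem_sym_subst.induct)
    (simp_all add: symmetric_poly_const symmetric_poly_elem_sym symmetric_poly_add symmetric_poly_mult)

lemma eval_poly_elem_sym_subst:
  "elem_sym_subst n p q \<Longrightarrow> eval_poly z q = eval_poly (symmetrize n z) p"
  by (induction rule: elem_sym_subst.induct)
    (simp_all add: eval_poly_single eval_poly_add eval_poly_mult eval_poly_Var eval_poly_elem_sym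
      symmetrize_def)

text \<open>
  The case of a variable is the definition of the symmetrization; the other cases hold because both
  functional calculi are ring homomorphisms.
\<close>

lemma eval_poly_op_elem_sym_subst:
  assumes T: "commuting_operators n T" and "elem_sym_subst n p q"
  shows "eval_poly_op T q = eval_poly_op (symmetrize_op n T) p"
  using assms(2)
proof (induction rule: elem_sym_subst.induct)
  case (const c)
  then show ?case by (simp add: fun_eq_iff eval_poly_op_single eval_monom_op_def)
next
  case (var k)
  then show ?case by (simp add: eval_poly_op_Var) (simp add: symmetrize_op_def)
next
  case (add p q p' q')
  then show ?case by (simp add: fun_eq_iff eval_poly_op_add)
next
  case (mult p q p' q')
  then have "p \<in> polys n" "p' \<in> polys n" "q \<in> polys n" "q' \<in> polys n"
    using elem_sym_subst_in_polys elem_sym_subst_symmetric unfolding symmetric_poly_def by blast+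
  with mult.IH show ?case
    by (simp add: fun_eq_iff eval_poly_op_mult[OF T]
        eval_poly_op_mult[OF commuting_operators_symmetrize_op[OF T]])
qed

section \<open>The fundamental theorem of symmetric polynomials\<close>

text \<open>
  Exponents are compared by the linear order on finitely supported maps, which is lexicographic with the
  smallest index dominating. Describing the leading term by a decomposition rather than by a maximum
  over the support avoids computing coefficients of products.
\<close>

definition monic_at :: "(nat \<Rightarrow>\<^sub>0 nat) \<Rightarrow> mpoly \<Rightarrow> bool" where
  "monic_at m p \<longleftrightarrow> (\<exists>r. p = Poly_Mapping.single m 1 + r \<and> (\<forall>k\<in>Poly_Mapping.keys r. k < m))"

lemma monic_at_one: "monic_at 0 1"
  unfolding monic_at_def by (rule exI[of _ 0]) simp

lemma monic_at_mult:
  assumes "monic_at m p" "monic_at m' p'"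
  shows "monic_at (m + m') (p * p')"
proof -
  from assms obtain r r' where p: "p = Poly_Mapping.single m 1 + r"
    and r: "\<And>k. k \<in> Poly_Mapping.keys r \<Longrightarrow> k < m"
    and p': "p' = Poly_Mapping.single m' 1 + r'"
    and r': "\<And>k. k \<in> Poly_Mapping.keys r' \<Longrightarrow> k < m'"
    unfolding monic_at_def by blast
  let ?s = "Poly_Mapping.single m 1 * r' + (r * Poly_Mapping.single m' 1 + r * r')"
  have "p * p' = Poly_Mapping.single (m + m') 1 + ?s"
    by (simp only: p p' distrib_left distrib_right mult_single mult_1_left add.assoc add.left_commute)
  moreover have "k < m + m'" if "k \<in> Poly_Mapping.keys ?s" for k
  proof -
    from that have "k \<in> Poly_Mapping.keys (Poly_Mapping.single m (1::complex) * r')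
        \<or> k \<in> Poly_Mapping.keys (r * Poly_Mapping.single m' 1) \<or> k \<in> Poly_Mapping.keys (r * r')"
      using keys_add[of "Poly_Mapping.single m 1 * r'" "r * Poly_Mapping.single m' 1 + r * r'"]
        keys_add[of "r * Poly_Mapping.single m' 1" "r * r'"] by blast
    then obtain a b where "k = a + b"
      "a = m \<and> b \<in> Poly_Mapping.keys r' \<or> a \<in> Poly_Mapping.keys r \<and> b = m'
        \<or> a \<in> Poly_Mapping.keys r \<and> b \<in> Poly_Mapping.keys r'"
      using keys_mult[of "Poly_Mapping.single m (1::complex)" r']
        keys_mult[of r "Poly_Mapping.single m' (1::complex)"] keys_mult[of r r'] by auto
    then show ?thesis
      using r r' by (auto intro: add_strict_left_mono add_strict_right_mono add_strict_mono)
  qed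
  ultimately show ?thesis unfolding monic_at_def by blast
qed

lemma less_monomI:
  fixes m m' :: "nat \<Rightarrow>\<^sub>0 nat"
  assumes "Poly_Mapping.lookup m k < Poly_Mapping.lookup m' k"
    and "\<And>j. j < k \<Longrightarrow> Poly_Mapping.lookup m j = Poly_Mapping.lookup m' j"
  shows "m < m'"
  unfolding less_poly_mapping.rep_eq using assms by (intro less_funI) blast

text \<open>
  The leading monomial of \<open>e\<^sub>i\<close> is the product of the first \<open>i\<close> variables: any other \<open>i\<close>-element set \<open>K\<close>
  misses one of them, and its monomial is smaller at the least index that it misses.
\<close>

lemma monic_at_elem_sym:
  assumes "i \<le> n"
  shows "monic_at (\<Sum>k\<in>{1..i}. Poly_Mapping.single k 1) (elem_sym n i Var)"
proof -
  let ?S = "{K. K \<subseteq> {1..n} \<and> card K = i}"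
  let ?m = "\<lambda>K. \<Sum>k\<in>K. Poly_Mapping.single k (1::nat)"
  have fin: "finite ?S" by simp
  have "elem_sym n i Var = Poly_Mapping.single (?m {1..i}) 1
      + (\<Sum>K\<in>?S - {{1..i}}. Poly_Mapping.single (?m K) 1)"
    unfolding elem_sym_def prod_Var by (rule sum.remove[OF fin]) (use assms in auto)
  moreover have "m < ?m {1..i}"
    if m: "m \<in> Poly_Mapping.keys (\<Sum>K\<in>?S - {{1..i}}. Poly_Mapping.single (?m K) (1::complex))" for m
  proof -
    from m obtain K where "K \<in> ?S - {{1..i}}"
      "m \<in> Poly_Mapping.keys (Poly_Mapping.single (?m K) (1::complex))"
      using keys_sum[of "\<lambda>K. Poly_Mapping.single (?m K) (1::complex)" "?S - {{1..i}}"]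
      by blast
    then have K: "K \<subseteq> {1..n}" "card K = i" "K \<noteq> {1..i}" and mK: "m = ?m K"
      by simp_all
    have finK: "finite K" using K(1) finite_subset by blast
    have "\<not> {1..i} \<subseteq> K"
      using K card_subset_eq[OF finK, of "{1..i}"] by auto
    then have ex: "\<exists>k. k \<in> {1..i} - K" by blast
    define k where "k = (LEAST k. k \<in> {1..i} - K)"
    have k: "k \<in> {1..i} - K"
      unfolding k_def using LeastI_ex[OF ex] .
    have least: "j \<notin> {1..i} - K" if "j < k" for j
      using not_less_Least that unfolding k_def by blast
    show "m < ?m {1..i}"
      unfolding mK
    proof (rule less_monomI)
      show "Poly_Mapping.lookup (?m K) k < Poly_Mapping.lookup (?m {1..i}) k"
        using k finK by (simp add: lookup_sum_single)
      show "Poly_Mapping.lookup (?m K) j = Poly_Mapping.lookup (?m {1..i}) j" if "j < k" for j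
        using least[OF that] that k finK K(1) by (auto simp: lookup_sum_single)
    qed
  qed
  ultimately show ?thesis unfolding monic_at_def by blast
qed

lemma sum_diff_Suc_nat:
  fixes f :: "nat \<Rightarrow> nat"
  assumes "k \<le> l" "\<And>i. k \<le> i \<Longrightarrow> i < l \<Longrightarrow> f (Suc i) \<le> f i"
  shows "(\<Sum>i\<in>{k..<l}. f i - f (Suc i)) + f l = f k"
  using assms
proof (induction l rule: dec_induct)
  case (step l)
  have "(\<Sum>i\<in>{k..<l}. f i - f (Suc i)) + f l = f k"
    by (rule step.IH) (simp add: step.prems)
  moreover have "f (Suc l) \<le> f l"
    using step.hyps by (intro step.prems) auto
  ultimately show ?case
    using step.hyps by simp
qed simp

text \<open>
  A decreasing exponent vector is a sum of indicator functions of initial segments \<open>{1..i}\<close>, the leading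
  exponents of the \<open>e\<^sub>i\<close>, with the successive differences as multiplicities: the coefficient at \<open>k\<close> collects
  the differences from \<open>k\<close> on, which telescope to \<open>m\<^sub>k\<close> since \<open>m\<^sub>n\<^sub>+\<^sub>1 = 0\<close>.
\<close>

lemma decreasing_monom_decomposition:
  assumes m: "Poly_Mapping.keys m \<subseteq> {1..n}"
    and dec: "\<And>k. 1 \<le> k \<Longrightarrow> k < n \<Longrightarrow> Poly_Mapping.lookup m (Suc k) \<le> Poly_Mapping.lookup m k"
  shows "(\<Sum>i\<in>{1..n}. \<Sum>_<Poly_Mapping.lookup m i - Poly_Mapping.lookup m (Suc i).
      \<Sum>k\<in>{1..i}. Poly_Mapping.single k (1::nat)) = m"
proof (rule poly_mapping_eqI)
  fix k
  let ?d = "\<lambda>i. Poly_Mapping.lookup m i - Poly_Mapping.lookup m (Suc i)"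
  have outside: "Poly_Mapping.lookup m j = 0" if "j \<notin> {1..n}" for j
    using m that by (auto simp: not_in_keys_iff_lookup_eq_zero[symmetric])
  have dec': "Poly_Mapping.lookup m (Suc i) \<le> Poly_Mapping.lookup m i" if "1 \<le> i" for i
    using dec[OF that] outside[of "Suc i"] by (cases "i < n") auto
  have "Poly_Mapping.lookup (\<Sum>i\<in>{1..n}. \<Sum>_<?d i. \<Sum>k\<in>{1..i}. Poly_Mapping.single k (1::nat)) k
      = (\<Sum>i\<in>{1..n}. if k \<in> {1..i} then ?d i else 0)"
    unfolding lookup_sum[of _ "{1..n}"] lookup_sum[of _ "{..<?d i}" for i]
    by (intro sum.cong refl) (simp add: lookup_sum_single)
  also have "\<dots> = Poly_Mapping.lookup m k"
  proof (cases "k \<in> {1..n}")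
    case True
    have "(\<Sum>i\<in>{1..n}. if k \<in> {1..i} then ?d i else 0) = (\<Sum>i\<in>{k..<Suc n}. ?d i)"
      using True by (intro sum.mono_neutral_cong_right) auto
    also have "\<dots> = Poly_Mapping.lookup m k"
      using sum_diff_Suc_nat[of k "Suc n" "Poly_Mapping.lookup m"] dec' outside[of "Suc n"] True
      by auto
    finally show ?thesis .
  next
    case False
    then show ?thesis using outside[OF False] by (auto intro!: sum.neutral)
  qed
  finally show "Poly_Mapping.lookup (\<Sum>i\<in>{1..n}. \<Sum>_<?d i. \<Sum>k\<in>{1..i}. Poly_Mapping.single k (1::nat)) k
      = Poly_Mapping.lookup m k" .
qed

text \<open>
  Leading exponents of polynomials in \<open>e\<^sub>1, \<dots>, e\<^sub>n\<close> with leading coefficient 1 form a monoid containing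
  the indicator functions of initial segments, hence all decreasing exponent vectors.
\<close>

lemma elem_sym_subst_monic_at:
  assumes m: "Poly_Mapping.keys m \<subseteq> {1..n}"
    and dec: "\<And>k. 1 \<le> k \<Longrightarrow> k < n \<Longrightarrow> Poly_Mapping.lookup m (Suc k) \<le> Poly_Mapping.lookup m k"
  shows "\<exists>p q. elem_sym_subst n p q \<and> monic_at m q"
proof -
  define attained where "attained m \<longleftrightarrow> (\<exists>p q. elem_sym_subst n p q \<and> monic_at m q)" for m
  have zero: "attained 0"
    unfolding attained_def using elem_sym_subst.const[of n 1] monic_at_one by auto
  have add: "attained (m + m')" if "attained m" "attained m'" for m m'
    using that unfolding attained_def by (blast intro: elem_sym_subst.mult monic_at_mult)
  have sum: "attained (\<Sum>i\<in>I. f i)" if "\<And>i. i \<in> I \<Longrightarrow> attained (f i)" for I :: "nat set" and f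
    using that by (induction I rule: infinite_finite_induct) (auto intro: zero add)
  have "attained (\<Sum>k\<in>{1..i}. Poly_Mapping.single k 1)" if "i \<in> {1..n}" for i
    unfolding attained_def using that elem_sym_subst.var[OF that] monic_at_elem_sym[of i n]
    by (metis atLeastAtMost_iff)
  then have "attained (\<Sum>i\<in>{1..n}. \<Sum>_<Poly_Mapping.lookup m i - Poly_Mapping.lookup m (Suc i).
      \<Sum>k\<in>{1..i}. Poly_Mapping.single k 1)"
    by (rule sum[OF sum])
  moreover have "(\<Sum>i\<in>{1..n}. \<Sum>_<Poly_Mapping.lookup m i - Poly_Mapping.lookup m (Suc i).
      \<Sum>k\<in>{1..i}. Poly_Mapping.single k 1) = m"
    by (rule decreasing_monom_decomposition[OF m]) (rule dec)
  ultimately have "attained m" by (simp only:)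
  then show ?thesis
    unfolding attained_def .
qed

text \<open>
  Without a bound on the support, the lexicographic order has infinite descending chains, such as
  the variables in their natural order. With finitely many variables it is the well-founded
  lexicographic order on lists of fixed length.
\<close>

lemma wf_monom_less:
  "wf {(m, m' :: nat \<Rightarrow>\<^sub>0 nat).
    Poly_Mapping.keys m \<subseteq> {1..n} \<and> Poly_Mapping.keys m' \<subseteq> {1..n} \<and> m < m'}"
proof (rule wf_subset)
  let ?l = "\<lambda>m :: nat \<Rightarrow>\<^sub>0 nat. map (Poly_Mapping.lookup m) [0..<Suc n]"
  show "wf (inv_image (lexn less_than (Suc n)) ?l)"
    by (intro wf_inv_image wf_lexn wf_less_than)
  show "{(m, m'). Poly_Mapping.keys m \<subseteq> {1..n} \<and> Poly_Mapping.keys m' \<subseteq> {1..n} \<and> m < m'}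
      \<subseteq> inv_image (lexn less_than (Suc n)) ?l"
  proof clarify
    fix m m' :: "nat \<Rightarrow>\<^sub>0 nat"
    assume m: "Poly_Mapping.keys m \<subseteq> {1..n}" "Poly_Mapping.keys m' \<subseteq> {1..n}" and "m < m'"
    then obtain k where k: "Poly_Mapping.lookup m k < Poly_Mapping.lookup m' k"
      and eq: "\<And>j. j < k \<Longrightarrow> Poly_Mapping.lookup m j = Poly_Mapping.lookup m' j"
      unfolding less_poly_mapping.rep_eq less_fun_def by blast
    have "k \<in> Poly_Mapping.keys m'" using k by (simp add: in_keys_iff)
    \<comment> \<open>The order compares all indices, so the lists start at index 0, where both exponents vanish.\<close>
    then have "k \<le> n" using m(2) by auto
    then have split: "[0..<Suc n] = [0..<k] @ k # [Suc k..<Suc n]"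
      using upt_add_eq_append[of 0 k "Suc n - k"] upt_conv_Cons[of k "Suc n"]
      by (simp del: upt_Suc)
    have "?l m = map (Poly_Mapping.lookup m') [0..<k] @ Poly_Mapping.lookup m k
        # map (Poly_Mapping.lookup m) [Suc k..<Suc n]"
      unfolding split using eq by simp
    moreover have "?l m' = map (Poly_Mapping.lookup m') [0..<k] @ Poly_Mapping.lookup m' k
        # map (Poly_Mapping.lookup m') [Suc k..<Suc n]"
      unfolding split by simp
    moreover have "(xs @ x # ys, xs @ y # ys') \<in> lexn less_than (Suc n)"
      if "length (xs @ x # ys) = Suc n" "length (xs @ y # ys') = Suc n" "x < y" for xs ys ys' and x y :: nat
      using that unfolding lexn_conv by (simp del: append.simps) blast
    ultimately show "(m, m') \<in> inv_image (lexn less_than (Suc n)) ?l"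
      using k \<open>k \<le> n\<close> by (simp del: upt_Suc)
  qed
qed

text \<open>
  Otherwise the transposition of two adjacent variables maps the leading monomial to a larger one, which
  by symmetry also occurs in \<open>q\<close>.
\<close>

lemma symmetric_poly_leading_decreasing:
  assumes q: "symmetric_poly n q" and m: "m \<in> Poly_Mapping.keys q"
    and max: "\<And>m'. m' \<in> Poly_Mapping.keys q \<Longrightarrow> m' \<le> m"
    and k: "1 \<le> k" "k < n"
  shows "Poly_Mapping.lookup m (Suc k) \<le> Poly_Mapping.lookup m k"
proof (rule ccontr)
  assume less: "\<not> ?thesis"
  define \<sigma> where "\<sigma> = Transposition.transpose k (Suc k)"
  have \<sigma>: "\<sigma> permutes {1..n}"
    unfolding \<sigma>_def using k by (intro permutes_swap_id) auto
  let ?m = "Poly_Mapping.map_key \<sigma> m"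
  have lookup: "Poly_Mapping.lookup ?m j = Poly_Mapping.lookup m (\<sigma> j)" for j
    by (simp add: map_key.rep_eq permutes_inj[OF \<sigma>])
  have "permute_vars \<sigma> q = q"
    using q \<sigma> by (simp add: symmetric_poly_def)
  then have "Poly_Mapping.lookup q ?m = Poly_Mapping.lookup q m"
    by (metis lookup_permute_vars[OF \<sigma>])
  then have "?m \<in> Poly_Mapping.keys q"
    using m by (simp add: in_keys_iff)
  then have "?m \<le> m" by (rule max)
  moreover have "m < ?m"
  proof (rule less_monomI)
    show "Poly_Mapping.lookup m k < Poly_Mapping.lookup ?m k"
      using less unfolding lookup by (simp add: \<sigma>_def)
    show "Poly_Mapping.lookup m j = Poly_Mapping.lookup ?m j" if "j < k" for j
      using that unfolding lookup by (simp add: \<sigma>_def transpose_def)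
  qed
  ultimately show False by simp
qed

text \<open>
  The fundamental theorem of symmetric polynomials: subtracting a multiple of a polynomial in
  \<open>e\<^sub>1, \<dots>, e\<^sub>n\<close> with the same leading monomial leaves a symmetric polynomial with a smaller one.
\<close>

lemma symmetric_poly_elem_sym_subst:
  assumes "symmetric_poly n q"
  shows "\<exists>p. elem_sym_subst n p q"
proof -
  have zero: "\<exists>p. elem_sym_subst n p 0"
    using elem_sym_subst.const[of n 0] by auto
  have nonzero: "symmetric_poly n q \<Longrightarrow> q \<noteq> 0 \<Longrightarrow> m = Max (Poly_Mapping.keys q) \<Longrightarrow> \<exists>p. elem_sym_subst n p q"
    for m q
  proof (induction m arbitrary: q rule: wf_induct_rule[OF wf_monom_less[of n]])
    case (1 m q)
    have m: "m \<in> Poly_Mapping.keys q"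
      using 1 Max_in[of "Poly_Mapping.keys q"] by auto
    have max: "m' \<le> m" if "m' \<in> Poly_Mapping.keys q" for m'
      using that 1 by simp
    have vars: "Poly_Mapping.keys m' \<subseteq> {1..n}" if "m' \<in> Poly_Mapping.keys q" "symmetric_poly n q" for m' q
      using that by (auto simp: symmetric_poly_def polys_def)
    define c where "c = Poly_Mapping.lookup q m"
    obtain p0 q0 where sub: "elem_sym_subst n p0 q0" and "monic_at m q0"
      using elem_sym_subst_monic_at[OF vars[OF m 1(2)] symmetric_poly_leading_decreasing[OF 1(2) m max]]
      by blast
    then obtain r where q0: "q0 = Poly_Mapping.single m 1 + r"
      and r: "\<And>k. k \<in> Poly_Mapping.keys r \<Longrightarrow> k < m"
      unfolding monic_at_def by blast
    \<comment> \<open>\<open>q1\<close> and \<open>r\<close> are what remains of \<open>q\<close> and \<open>q0\<close> below the leading monomial.\<close>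
    define q1 where "q1 = q - Poly_Mapping.single m c"
    have q1: "k < m" if "k \<in> Poly_Mapping.keys q1" for k
    proof -
      have "k \<noteq> m"
        using that by (auto simp: q1_def in_keys_iff lookup_minus c_def)
      moreover from this that have "k \<in> Poly_Mapping.keys q"
        by (simp add: q1_def in_keys_iff lookup_minus lookup_single)
      ultimately show ?thesis using max[of k] by simp
    qed
    let ?q = "q + Poly_Mapping.single 0 (-c) * q0"
    have q_eq: "?q = q1 + Poly_Mapping.single 0 (-c) * r"
    proof -
      have "Poly_Mapping.single 0 (-c) * Poly_Mapping.single m 1 = - Poly_Mapping.single m c"
        by (simp add: mult_single single_uminus)
      then show ?thesis
        by (simp only: q0 q1_def distrib_left diff_conv_add_uminus add.assoc)
    qed
    have keys: "k < m" if "k \<in> Poly_Mapping.keys ?q" for k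
    proof -
      from that have "k \<in> Poly_Mapping.keys q1 \<or> k \<in> Poly_Mapping.keys (Poly_Mapping.single 0 (-c) * r)"
        unfolding q_eq using keys_add[of q1 "Poly_Mapping.single 0 (-c) * r"] by blast
      then show ?thesis
      proof
        assume "k \<in> Poly_Mapping.keys (Poly_Mapping.single 0 (-c) * r)"
        then obtain a b where ab: "k = a + b"
          "a \<in> Poly_Mapping.keys (Poly_Mapping.single (0 :: nat \<Rightarrow>\<^sub>0 nat) (-c))"
          "b \<in> Poly_Mapping.keys r"
          using keys_mult[of "Poly_Mapping.single 0 (-c)" r] by blast
        from ab(2) have "a = 0" by (cases "c = 0") simp_all
        with ab r show ?thesis by simp
      qed (rule q1)
    qed
    have sym: "symmetric_poly n ?q"
      by (intro symmetric_poly_add symmetric_poly_mult symmetric_poly_const 1(2)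
          elem_sym_subst_symmetric[OF sub])
    have "\<exists>p. elem_sym_subst n p ?q"
    proof (cases "?q = 0")
      case True
      then show ?thesis using zero by simp
    next
      case False
      then have "Max (Poly_Mapping.keys ?q) \<in> Poly_Mapping.keys ?q"
        by (intro Max_in) auto
      with vars[OF _ sym] vars[OF m 1(2)] keys
      have "(Max (Poly_Mapping.keys ?q), m) \<in> {(m, m'). Poly_Mapping.keys m \<subseteq> {1..n}
          \<and> Poly_Mapping.keys m' \<subseteq> {1..n} \<and> m < m'}" by blast
      then show ?thesis by (rule 1(1)[OF _ sym False refl])
    qed
    then obtain p1 where "elem_sym_subst n p1 ?q" by blast
    then have "elem_sym_subst n (p1 + Poly_Mapping.single 0 c * p0) (?q + Poly_Mapping.single 0 c * q0)"
      by (rule elem_sym_subst.add[OF _ elem_sym_subst.mult[OF elem_sym_subst.const sub]])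
    moreover have "?q + Poly_Mapping.single 0 c * q0 = q"
      by (simp only: single_uminus mult_minus_left add.assoc left_minus add_0_right)
    ultimately have "elem_sym_subst n (p1 + Poly_Mapping.single 0 c * p0) q" by (simp only:)
    then show ?case by blast
  qed
  show ?thesis
  proof (cases "q = 0")
    case True
    then show ?thesis using zero by simp
  next
    case False
    then show ?thesis using nonzero[OF assms _ refl] by simp
  qed
qed

section \<open>Contractions with respect to the symmetrized polydisc\<close>

theorem proposition2p13:
  fixes n :: nat and T :: "nat \<Rightarrow> 'a::complex_hilbert_space \<Rightarrow> 'a"
  assumes "1 \<le> n"
    and "commuting_contractions n T"
  shows "Gamma_contraction n (symmetrize_op n T) \<longleftrightarrow>
    (\<forall>q. symmetric_poly n q \<longrightarrow>
      onorm (eval_poly_op T q) \<le> (SUP z\<in>closed_polydisc n. cmod (eval_poly z q)))"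
proof -
  have T: "commuting_operators n T"
    using assms(2) by (simp add: commuting_contractions_def commuting_operators_def)
  \<comment> \<open>For each pair the two inequalities have the same sides: equal operators, and suprema over the
    same set of values.\<close>
  have iff: "onorm (eval_poly_op (symmetrize_op n T) p) \<le> (SUP w\<in>Gamma_set n. cmod (eval_poly w p))
      \<longleftrightarrow> onorm (eval_poly_op T q) \<le> (SUP z\<in>closed_polydisc n. cmod (eval_poly z q))"
    if "elem_sym_subst n p q" for p q
    by (simp add: eval_poly_op_elem_sym_subst[OF T that] eval_poly_elem_sym_subst[OF that]
        Gamma_set_def image_image)
  have "Gamma_contraction n (symmetrize_op n T) \<longleftrightarrow> (\<forall>p\<in>polys n.
      onorm (eval_poly_op (symmetrize_op n T) p) \<le> (SUP w\<in>Gamma_set n. cmod (eval_poly w p)))"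
    using commuting_operators_symmetrize_op[OF T]
    unfolding Gamma_contraction_def commuting_operators_def by blast
  also have "\<dots> \<longleftrightarrow> (\<forall>q. symmetric_poly n q \<longrightarrow>
      onorm (eval_poly_op T q) \<le> (SUP z\<in>closed_polydisc n. cmod (eval_poly z q)))"
  proof (intro iffI allI impI ballI)
    fix q
    assume *: "\<forall>p\<in>polys n. onorm (eval_poly_op (symmetrize_op n T) p)
        \<le> (SUP w\<in>Gamma_set n. cmod (eval_poly w p))" and "symmetric_poly n q"
    then obtain p where "elem_sym_subst n p q"
      using symmetric_poly_elem_sym_subst by blast
    with * iff[OF this] elem_sym_subst_in_polys[OF this]
    show "onorm (eval_poly_op T q) \<le> (SUP z\<in>closed_polydisc n. cmod (eval_poly z q))" by blast
  next
    fix p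
    assume *: "\<forall>q. symmetric_poly n q \<longrightarrow>
      onorm (eval_poly_op T q) \<le> (SUP z\<in>closed_polydisc n. cmod (eval_poly z q))" and "p \<in> polys n"
    then obtain q where "elem_sym_subst n p q"
      using elem_sym_subst_exists by blast
    with * iff[OF this] elem_sym_subst_symmetric[OF this]
    show "onorm (eval_poly_op (symmetrize_op n T) p)
        \<le> (SUP w\<in>Gamma_set n. cmod (eval_poly w p))" by blast
  qed
  finally show ?thesis .
qed

end
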